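(* Let $d$ be an integer with $\sqrt{d}\notin\mathbb{Q}$, and let $f\colon\mathbb{Q}(\sqrt{d})\to\mathbb{Q}(\sqrt{d})$ be an SD map. Then $f(z)=z$ for all $z\in\mathbb{Q}(\sqrt{d})$, or $f(z)=\overline{z}$ for all $z\in\mathbb{Q}(\sqrt{d})$.
   Context: An SD map on a field $\mathbb{F}$ is a function $f\colon \mathbb{F}\to\mathbb{F}$ such that for all $x \neq y$ in $\mathbb{F}$ one has $f(x)\neq f(y)$ and $f\left(\frac{x+y}{x-y}\right) = \frac{f(x)+f(y)}{f(x)-f(y)}$. Conjugation on $\mathbb{Q}(\sqrt{d})$ is defined by $\overline{a+b\sqrt{d}}=a-b\sqrt{d}$ for $a,b\in\mathbb{Q}$. *)

theory Defs
  imports Complex_Main "HOL-Library.FuncSet"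
begin

text \<open>
  Since \<open>d\<close> may be negative, the field \<open>\<rat>(\<surd>d)\<close> is taken inside the complex numbers,
  with the principal square root.
\<close>

definition quad_field :: "int \<Rightarrow> complex set"
  where "quad_field d = {a + b * csqrt (of_int d) | a b. a \<in> \<rat> \<and> b \<in> \<rat>}"

text \<open>Only meaningful for \<open>z \<in> quad_field d\<close> and irrational \<open>\<surd>d\<close>; see \<open>quad_conj_eq\<close>.\<close>

definition quad_conj :: "int \<Rightarrow> complex \<Rightarrow> complex"
  where "quad_conj d z =
    (THE w. \<exists>a\<in>\<rat>. \<exists>b\<in>\<rat>. z = a + b * csqrt (of_int d) \<and> w = a - b * csqrt (of_int d))"

text \<open>The field is given as a subfield \<open>K\<close> of the ambient type; values of \<open>f\<close> outside \<open>K\<close>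
  play no role.\<close>

definition SD_map_on :: "'a::field set \<Rightarrow> ('a \<Rightarrow> 'a) \<Rightarrow> bool"
  where "SD_map_on K f \<longleftrightarrow> f \<in> K \<rightarrow> K \<and>
    (\<forall>x\<in>K. \<forall>y\<in>K. x \<noteq> y \<longrightarrow>
       f x \<noteq> f y \<and> f ((x + y) / (x - y)) = (f x + f y) / (f x - f y))"

definition is_subfield :: "'a::field set \<Rightarrow> bool"
  where "is_subfield K \<longleftrightarrow> 0 \<in> K \<and> 1 \<in> K \<and>
    (\<forall>x\<in>K. \<forall>y\<in>K. x - y \<in> K \<and> x * y \<in> K) \<and> (\<forall>x\<in>K. inverse x \<in> K)"

lemma quad_repr_unique:
  assumes "csqrt (of_int d) \<notin> \<rat>" "a \<in> \<rat>" "b \<in> \<rat>" "a' \<in> \<rat>" "b' \<in> \<rat>"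
    and eq: "a + b * csqrt (of_int d) = a' + b' * csqrt (of_int d)"
  shows "a = a' \<and> b = b'"
proof -
  have "b = b'"
  proof (rule ccontr)
    assume "b \<noteq> b'"
    then have "csqrt (of_int d) = (a' - a) / (b - b')"
      using eq by (simp add: field_simps)
    also have "\<dots> \<in> \<rat>" using assms by simp
    finally show False using assms(1) by simp
  qed
  with eq show ?thesis by simp
qed

lemma quad_conj_eq:
  assumes "csqrt (of_int d) \<notin> \<rat>" "a \<in> \<rat>" "b \<in> \<rat>"
  shows "quad_conj d (a + b * csqrt (of_int d)) = a - b * csqrt (of_int d)"
  unfolding quad_conj_def
proof (rule the_equality)
  show "\<exists>a'\<in>\<rat>. \<exists>b'\<in>\<rat>. a + b * csqrt (of_int d) = a' + b' * csqrt (of_int d)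
      \<and> a - b * csqrt (of_int d) = a' - b' * csqrt (of_int d)"
    using assms by blast
next
  fix w
  assume "\<exists>a'\<in>\<rat>. \<exists>b'\<in>\<rat>. a + b * csqrt (of_int d) = a' + b' * csqrt (of_int d)
      \<and> w = a' - b' * csqrt (of_int d)"
  then show "w = a - b * csqrt (of_int d)"
    using quad_repr_unique[OF assms] by blast
qed

lemma csqrt_of_int_mult_self: "csqrt (of_int d) * csqrt (of_int d) = of_int d"
  by (metis power2_csqrt power2_eq_square)

lemma is_subfield_quad_field:
  assumes "csqrt (of_int d) \<notin> \<rat>"
  shows "is_subfield (quad_field d)"
proof -
  let ?s = "csqrt (of_int d)"
  have I: "a + b * ?s \<in> quad_field d" if "a \<in> \<rat>" "b \<in> \<rat>" for a b
    using that unfolding quad_field_def by blast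
  have diff: "x - y \<in> quad_field d" and mult: "x * y \<in> quad_field d"
    if xy: "x \<in> quad_field d" "y \<in> quad_field d" for x y
  proof -
    obtain a b where x: "x = a + b * ?s" "a \<in> \<rat>" "b \<in> \<rat>"
      using xy(1) unfolding quad_field_def by blast
    obtain a' b' where y: "y = a' + b' * ?s" "a' \<in> \<rat>" "b' \<in> \<rat>"
      using xy(2) unfolding quad_field_def by blast
    have "x - y = (a - a') + (b - b') * ?s"
      unfolding x y by (simp add: algebra_simps)
    then show "x - y \<in> quad_field d" using I[of "a - a'" "b - b'"] x(2,3) y(2,3) by simp
    have "x * y = (a * a' + b * b' * (?s * ?s)) + (a * b' + a' * b) * ?s"
      unfolding x y by (simp only: algebra_simps)
    then have "x * y = (a * a' + b * b' * of_int d) + (a * b' + a' * b) * ?s"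
      by (simp only: csqrt_of_int_mult_self)
    then show "x * y \<in> quad_field d"
      using I[of "a * a' + b * b' * of_int d" "a * b' + a' * b"] x(2,3) y(2,3) by simp
  qed
  have inv: "inverse x \<in> quad_field d" if xq: "x \<in> quad_field d" for x
  proof (cases "x = 0")
    case True
    then show ?thesis using I[of 0 0] by simp
  next
    case False
    obtain a b where x: "x = a + b * ?s" "a \<in> \<rat>" "b \<in> \<rat>"
      using xq unfolding quad_field_def by blast
    define y where "y = a + (- b) * ?s"
    define n where "n = a * a - b * b * of_int d"
    have "x * y = a * a - b * b * (?s * ?s)"
      unfolding x y_def by (simp add: algebra_simps)
    then have n: "x * y = n"
      by (simp only: csqrt_of_int_mult_self n_def)
    have "y \<noteq> 0"
      using quad_repr_unique[OF assms, of a "-b" 0 0] x False unfolding y_def by auto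
    with n False have n0: "n \<noteq> 0" by auto
    have "inverse x = y / n"
      using n n0 False by (simp add: field_simps)
    also have "\<dots> = a / n + (- b / n) * ?s"
      by (simp add: y_def add_divide_distrib diff_divide_distrib)
    also have "\<dots> \<in> quad_field d"
      using x by (intro I) (auto simp: n_def)
    finally show ?thesis .
  qed
  have "0 \<in> quad_field d" "1 \<in> quad_field d"
    using I[of 0 0] I[of 1 0] by simp_all
  with diff mult inv show ?thesis unfolding is_subfield_def by blast
qed

lemma quad_field_least:
  assumes "is_subfield K" "csqrt (of_int d) \<in> K"
  shows "quad_field d \<subseteq> K"
proof -
  have diff: "x - y \<in> K" and mult: "x * y \<in> K" and inv: "inverse x \<in> K"
    and zero: "0 \<in> K" and one: "1 \<in> K" if "x \<in> K" "y \<in> K" for x y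
    using assms(1) that unfolding is_subfield_def by auto
  have zo: "0 \<in> K" "1 \<in> K" using assms(1) unfolding is_subfield_def by auto
  have uminus: "- x \<in> K" if "x \<in> K" for x using diff[OF zo(1) that] by simp
  have add: "x + y \<in> K" if "x \<in> K" "y \<in> K" for x y
    using diff[OF that(1) uminus[OF that(2)]] by simp
  have nat: "of_nat n \<in> K" for n by (induction n) (auto simp: zo add)
  have int: "of_int k \<in> K" for k by (cases k) (auto simp: nat intro!: uminus simp del: of_nat_Suc)
  have rat: "q \<in> K" if "q \<in> \<rat>" for q
    using that by (auto elim!: Rats_cases' simp: divide_inverse intro!: mult inv int zo)
  show ?thesis unfolding quad_field_def using assms(2) add mult rat by blast
qed

end

theory Submission imports Defs
begin

text \<open>
  An SD map is multiplicative, so the defining identity becomes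
  \<open>f (x + y) (f x - f y) = f (x - y) (f x + f y)\<close>. Computing \<open>f 5\<close> from \<open>5 = 3 + 2\<close> and from
  \<open>5 = 4 + 1\<close> forces \<open>f 2 = 2\<close>, and then \<open>f\<close> fixes the rationals. For \<open>s\<^sup>2 \<in> \<rat>\<close>
  put \<open>t = f s\<close>, so \<open>t = \<plusminus>s\<close>; the identity at \<open>(a, b s)\<close>, together with the norm of
  \<open>a + b s\<close>, gives \<open>f (a + b s) = \<plusminus>(a + b t)\<close>. If the sign at \<open>w = a + b t\<close> were negative,
  the identity at \<open>(a + b s, r)\<close> with \<open>r\<close> rational would give
  \<open>(w - r)\<^sup>4 = (w + r)\<^sup>4\<close>, that is \<open>w\<^sup>2 = - r\<^sup>2\<close> for every \<open>r \<noteq> 0\<close>, which is absurd.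
\<close>

locale sd_map =
  fixes K :: "'a::field_char_0 set" and f :: "'a \<Rightarrow> 'a"
  assumes subfield: "is_subfield K" and SD: "SD_map_on K f"
begin

lemma zero_closed [simp]: "0 \<in> K" and one_closed [simp]: "1 \<in> K"
  and diff_closed [simp]: "x \<in> K \<Longrightarrow> y \<in> K \<Longrightarrow> x - y \<in> K"
  and mult_closed [simp]: "x \<in> K \<Longrightarrow> y \<in> K \<Longrightarrow> x * y \<in> K"
  and inverse_closed [simp]: "x \<in> K \<Longrightarrow> inverse x \<in> K"
  using subfield unfolding is_subfield_def by auto

lemma minus_closed [simp]: "x \<in> K \<Longrightarrow> - x \<in> K"
  using diff_closed[of 0 x] by simp

lemma add_closed [simp]: "x \<in> K \<Longrightarrow> y \<in> K \<Longrightarrow> x + y \<in> K"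
  using diff_closed[of x "- y"] by simp

lemma divide_closed [simp]: "x \<in> K \<Longrightarrow> y \<in> K \<Longrightarrow> x / y \<in> K"
  by (simp add: divide_inverse)

lemma of_nat_closed [simp]: "of_nat n \<in> K"
  by (induction n) auto

lemma numeral_closed [simp]: "numeral n \<in> K"
  using of_nat_closed[of "numeral n"] by simp

lemma of_int_closed [simp]: "of_int k \<in> K"
  by (cases k) (auto simp del: of_nat_Suc)

lemma Rats_closed: "q \<in> \<rat> \<Longrightarrow> q \<in> K"
  by (auto elim!: Rats_cases')

lemma SD_eq:
  "x \<in> K \<Longrightarrow> y \<in> K \<Longrightarrow> x \<noteq> y \<Longrightarrow> f ((x + y) / (x - y)) = (f x + f y) / (f x - f y)"
  using SD unfolding SD_map_on_def by blast

lemma f_eq_iff: "x \<in> K \<Longrightarrow> y \<in> K \<Longrightarrow> f x = f y \<longleftrightarrow> x = y"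
  using SD unfolding SD_map_on_def by blast

text \<open>The identity at \<open>(x, 0)\<close> makes \<open>(f 1 - 1) * f x\<close> the same for
  all \<open>x \<noteq> 0\<close>. Comparing \<open>x = 1\<close> with \<open>x = 2\<close>,
  injectivity leaves only \<open>f 1 = 1\<close>.\<close>

lemma f_one [simp]: "f 1 = 1" and f_zero [simp]: "f 0 = 0"
proof -
  have eq: "(f 1 - 1) * f x = (f 1 + 1) * f 0" if "x \<in> K" "x \<noteq> 0" for x
    using SD_eq[of x 0] f_eq_iff[of x 0] that by (simp add: field_simps)
  have "(f 1 - 1) * f 1 = (f 1 - 1) * f 2"
    using eq[of 1] eq[of 2] by simp
  then show 1: "f 1 = 1"
    using f_eq_iff[of 1 2] by simp
  show "f 0 = 0"
    using eq[of 1] 1 by simp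
qed

lemma f_eq_0_iff: "x \<in> K \<Longrightarrow> f x = 0 \<longleftrightarrow> x = 0"
  using f_eq_iff[of x 0] by simp

lemma f_minus: "x \<in> K \<Longrightarrow> f (- x) = - f x"
  using SD_eq[of x "- x"] f_eq_iff[of x "- x"]
  by (cases "x = 0") (auto simp: eq_neg_iff_add_eq_0 add.commute)

text \<open>The quotient \<open>(x + y) / (x - y)\<close> does not change when \<open>x\<close> and
  \<open>y\<close> are scaled by \<open>z\<close>. Hence \<open>f (x * z) / f z\<close> and
  \<open>f x\<close> have the same image under the injective map
  \<open>(t + 1) / (t - 1)\<close>.\<close>

lemma f_mult:
  assumes "x \<in> K" "z \<in> K"
  shows "f (x * z) = f x * f z"
proof (cases "x = 1 \<or> z = 0")
  case True
  then show ?thesis by auto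
next
  case False
  have "(x * z + z) / (x * z - z) = (x + 1) / (x - 1)"
    using False by (simp add: divide_simps) (simp add: algebra_simps)
  then have "(f (x * z) + f z) / (f (x * z) - f z) = (f x + 1) / (f x - 1)"
    using SD_eq[of "x * z" z] SD_eq[of x 1] assms False by simp
  moreover have "f (x * z) \<noteq> f z" "f x \<noteq> 1"
    using f_eq_iff[of "x * z" z] f_eq_iff[of x 1] assms False by auto
  ultimately have "(f (x * z) + f z) * (f x - 1) = (f x + 1) * (f (x * z) - f z)"
    by (simp add: frac_eq_eq)
  then have "2 * f (x * z) = 2 * (f x * f z)"
    by (simp add: algebra_simps)
  then show ?thesis by simp
qed

lemma f_add_diff:
  assumes "x \<in> K" "y \<in> K"
  shows "f (x + y) * (f x - f y) = f (x - y) * (f x + f y)"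
proof (cases "x = y")
  case False
  then have "f (x + y) = f ((x + y) / (x - y)) * f (x - y)"
    using assms by (simp flip: f_mult)
  then show ?thesis
    using SD_eq[OF assms False] f_eq_iff[OF assms] False by simp
qed simp

lemma f_two: "f 2 = 2"
proof -
  define a b where "a = f 2" and "b = f 3"
  have a: "a \<noteq> 0" "a \<noteq> 1"
    using f_eq_0_iff[of 2] f_eq_iff[of 2 1] by (auto simp: a_def)
  have f4: "f 4 = a * a"
    using f_mult[of 2 2] by (simp add: a_def)
  have f3: "b * (a - 1) = a + 1"
    using f_add_diff[of 2 1] by (simp add: a_def b_def)
  have f5: "f 5 * (b - a) = b + a" "f 5 * (a * a - 1) = b * (a * a + 1)"
    using f_add_diff[of 3 2] f_add_diff[of 4 1] f4 by (simp_all add: a_def b_def)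
  \<comment> \<open>Multiplying by \<open>a - 1\<close> eliminates \<open>b\<close> through
    \<open>f3\<close>. Both formulas for \<open>f 5\<close> end up with the right side
    \<open>a * a + 1\<close> and can be subtracted.\<close>
  have "f 5 * (b - a) * (a - 1) = a * a + 1"
    using f3 f5(1) by algebra
  then have 1: "f 5 * (1 + 2 * a - a * a) = a * a + 1"
    using f3 by algebra
  have "a + 1 \<noteq> 0"
    using f_eq_iff[of 2 "-1"] f_minus[of 1] by (auto simp: a_def eq_neg_iff_add_eq_0)
  moreover have "(a + 1) * (f 5 * ((a - 1) * (a - 1))) = (a + 1) * (a * a + 1)"
    using f3 f5(2) by algebra
  ultimately have "f 5 * ((a - 1) * (a - 1)) = a * a + 1"
    by simp
  with 1 have "f 5 * (2 * a * (a - 2)) = 0"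
    by algebra
  then show ?thesis
    using a f_eq_0_iff[of 5] by (simp add: a_def)
qed

lemma f_of_nat: "f (of_nat n) = of_nat n"
proof (induction n rule: less_induct)
  case (less n)
  \<comment> \<open>The identity at \<open>(n - 1, 1)\<close> yields \<open>f n\<close> only after
    division by \<open>n - 2\<close>. It is void at \<open>n = 2\<close>, which therefore is a base
    case.\<close>
  consider "n = 0" | "n = 1" | "n = 2" | m where "n = m + 3"
    by (metis add.commute add_2_eq_Suc' add_Suc_right not0_implies_Suc numeral_3_eq_3 One_nat_def
        Suc_1)
  then show ?case
  proof cases
    case 4
    have "f (of_nat (m + 2) + 1) * (f (of_nat (m + 2)) - f 1)
        = f (of_nat (m + 2) - 1) * (f (of_nat (m + 2)) + f 1)"
      by (intro f_add_diff) simp_all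
    moreover have "of_nat (m + 2) + 1 = (of_nat n :: 'a)" "of_nat (m + 2) - 1 = (of_nat (m + 1) :: 'a)"
      by (simp_all add: 4)
    ultimately have "f (of_nat n) * of_nat (m + 1) = of_nat (m + 1) * of_nat n"
      using less.IH[of "m + 2"] less.IH[of "m + 1"] 4 by (simp add: algebra_simps)
    then show ?thesis
      by (metis Suc_eq_plus1 mult.commute mult_cancel_left of_nat_neq_0)
  qed (simp_all add: f_two)
qed

lemma f_of_int: "f (of_int k) = of_int k"
proof (cases k)
  case (nonneg n)
  then show ?thesis using f_of_nat by simp
next
  case (neg n)
  then show ?thesis
    using f_of_nat[of "Suc n"] f_minus[of "of_nat (Suc n)"] by (simp del: of_nat_Suc)
qed

lemma f_Rats: "q \<in> \<rat> \<Longrightarrow> f q = q"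
proof (elim Rats_cases')
  fix m n :: int
  assume n: "n > 0" and q: "q = of_int m / of_int n"
  then have "f q * of_int n = q * of_int n"
    using f_mult[of q "of_int n"] by (simp add: f_of_int)
  then show "f q = q"
    using n by simp
qed

text \<open>The norm of \<open>a + b * s\<close> is rational, hence fixed, which gives the product
  of \<open>f (a + b * s)\<close> and \<open>f (a - b * s)\<close>. \<open>f_add_diff\<close>
  relates the two linearly. Eliminating the second leaves the square of the first.\<close>

lemma f_square_Rats:
  assumes "a \<in> \<rat>" "b \<in> \<rat>" "s \<in> K" "s * s \<in> \<rat>" "s \<notin> \<rat>"
  shows "(f (a + b * s))\<^sup>2 = (a + b * f s)\<^sup>2"
proof (cases "b = 0")
  case True
  then show ?thesis using f_Rats assms by simp
next
  case False
  have K: "a \<in> K" "b * s \<in> K"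
    using assms by (simp_all add: Rats_closed)
  have ne: "a \<noteq> b * s"
    using assms False by (metis Rats_divide nonzero_mult_div_cancel_left)
  have fb: "f (b * s) = b * f s"
    using assms by (simp add: f_mult f_Rats Rats_closed)
  have "f s * f s = s * s"
    using f_mult[of s s] assms f_Rats by simp
  then have "(a + b * s) * (a - b * s) = (a + b * f s) * (a - b * f s)"
    by algebra
  moreover have "(a + b * s) * (a - b * s) = a * a - b * b * (s * s)"
    by algebra
  then have "(a + b * s) * (a - b * s) \<in> \<rat>"
    using assms by (metis Rats_diff Rats_mult)
  ultimately have norm: "f (a + b * s) * f (a - b * s) = (a + b * f s) * (a - b * f s)"
    using f_mult[of "a + b * s" "a - b * s"] f_Rats K by simp
  have "f (a + b * s) * (a - b * f s) = f (a - b * s) * (a + b * f s)"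
    using f_add_diff[OF K] fb f_Rats assms by simp
  with norm have "(f (a + b * s))\<^sup>2 * (a - b * f s) = (a + b * f s)\<^sup>2 * (a - b * f s)"
    by algebra
  \<comment> \<open>This is injectivity at \<open>a\<close> and \<open>b * s\<close>, whose images
    are \<open>a\<close> and \<open>b * f s\<close>.\<close>
  moreover have "a - b * f s \<noteq> 0"
    using f_eq_iff[OF K] ne fb f_Rats assms by simp
  ultimately show ?thesis by simp
qed

lemma f_quadratic:
  assumes "a \<in> \<rat>" "b \<in> \<rat>" "s \<in> K" "s * s \<in> \<rat>" "s \<notin> \<rat>"
  shows "f (a + b * s) = a + b * f s"
proof (rule ccontr)
  define z w where "z = a + b * s" and "w = a + b * f s"
  assume "f (a + b * s) \<noteq> a + b * f s"
  then have "f z \<noteq> w"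
    by (simp add: z_def w_def)
  moreover have "(f z)\<^sup>2 = w\<^sup>2"
    unfolding z_def w_def by (rule f_square_Rats[OF assms])
  ultimately have fz: "f z = - w" and w0: "w \<noteq> 0"
    by (auto simp: power2_eq_iff)
  have zK: "z \<in> K"
    using assms by (simp add: z_def Rats_closed)
  have key: "w\<^sup>2 = - r\<^sup>2" if r: "r \<in> \<rat>" "r \<noteq> 0" for r
  proof -
    \<comment> \<open>A rational shift only changes \<open>a\<close>, so the square of
      \<open>f (z + q)\<close> is known as well.\<close>
    have add: "(f (z + q))\<^sup>2 = (w + q)\<^sup>2" if "q \<in> \<rat>" for q
      using f_square_Rats[of "a + q" b s] assms that by (simp add: z_def w_def algebra_simps)
    have "f (z + r) * (- w - r) = f (z - r) * (- w + r)"
      using f_add_diff[of z r] zK r fz by (simp add: f_Rats Rats_closed)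
    moreover have "(f (z + r))\<^sup>2 = (w + r)\<^sup>2" "(f (z - r))\<^sup>2 = (w - r)\<^sup>2"
      using add[of r] add[of "- r"] r by simp_all
    \<comment> \<open>Squaring the identity removes the unknown signs of \<open>f (z + r)\<close>
      and \<open>f (z - r)\<close>. The left side is \<open>(w + r)^4 - (w - r)^4\<close>.\<close>
    ultimately have "8 * w * r * (w\<^sup>2 + r\<^sup>2) = 0"
      by algebra
    then show ?thesis
      using w0 r by (simp add: eq_neg_iff_add_eq_0)
  qed
  show False
    using key[of 1] key[of 2] by simp
qed

end

theorem theorem5p3:
  fixes d :: int and f :: "complex \<Rightarrow> complex"
  assumes "csqrt (of_int d) \<notin> \<rat>"
    and "SD_map_on (quad_field d) f"
  shows "(\<forall>z\<in>quad_field d. f z = z) \<or> (\<forall>z\<in>quad_field d. f z = quad_conj d z)"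
proof -
  define s where "s = csqrt (of_int d)"
  interpret sd_map "quad_field d" f
    using assms is_subfield_quad_field by unfold_locales
  have "s = 0 + 1 * csqrt (of_int d)"
    by (simp add: s_def)
  then have s: "s \<in> quad_field d"
    unfolding quad_field_def using Rats_0 Rats_1 by blast
  have ss: "s * s \<in> \<rat>"
    unfolding s_def csqrt_of_int_mult_self by simp
  have f: "f (a + b * s) = a + b * f s" if "a \<in> \<rat>" "b \<in> \<rat>" for a b
    using f_quadratic[OF that s ss] assms(1) by (simp add: s_def)
  \<comment> \<open>By linearity only \<open>f s\<close> remains to be found; its two possible signs
    give the identity and the conjugation.\<close>
  have "f s * f s = s * s"
    using f_mult[OF s s] f_Rats[OF ss] by simp
  then consider "f s = s" | "f s = - s"
    by (auto simp: square_eq_iff)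
  then show ?thesis
  proof cases
    case 1
    then have "\<forall>z\<in>quad_field d. f z = z"
      using f by (auto simp: quad_field_def s_def)
    then show ?thesis ..
  next
    case 2
    then have "\<forall>z\<in>quad_field d. f z = quad_conj d z"
      using f by (auto simp: quad_field_def quad_conj_eq[OF assms(1)] s_def)
    then show ?thesis ..
  qed
qed

end
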